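(* Let $n$ be the number of users and $N$ the number of base stations, and let the constants $\eta^2$, $M$, $\hat P_j$, $B_j$, $r_i$, $a_\ell>0$, $b_\ell\in(0,1)$, $\tilde\mu_{ij}$, $\tilde\sigma_{ij}$, $\alpha_i$ be given for $i\in[n]$, $j\in[N]$, $\ell\in[m]$ (their meaning is described in the context). Put $c=\frac{\log 10}{10}$ and $A_{ij\ell}=\frac{1}{b_\ell}\log\left(\frac{B_j a_\ell}{r_i}\right)$. Let $\rho_{ij}$, $i\in[n]$, $j\in[N]$, be Gaussian random variables with zero mean and unit standard deviation, and let the random channel gains be $g_{ij}=e^{c(\tilde\mu_{ij}+\rho_{ij}\tilde\sigma_{ij})}$. For each user $i\in[n]$ let the uncertainty box be given by intervals $[\underline\rho_{ij},\overline\rho_{ij}]$, $j\in[N]$, such that $$\mathbb{P}(\underline\rho_{ij}\le\rho_{ij}\le\overline\rho_{ij})=\frac{\operatorname{erf}\left[\overline\rho_{ij}/\sqrt2\right]-\operatorname{erf}\left[\underline\rho_{ij}/\sqrt2\right]}{2}=\varphi_j\quad (j\in[N]),\qquad \prod_{j=1}^N\varphi_j=1-\alpha_i.$$ Consider the robust mixed-integer geometric program (Robust-MIGP) $$\min_{\bar z_{ij},u_{ij},q_j}\ \sum_{j=1}^N e^{q_j}$$ subject to (1) $e^{u_{ij}}\le 1$ for $i\in[n]$, $j\in[N]$; (2) $\bar z_{ij}\in\{0,1\}$ for $i\in[n]$, $j\in[N]$; (3) $e^{q_j}\le\hat P_j$ for $j\in[N]$; (4) $\sum_{j=1}^N\bar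 z_{ij}=N-1$ for $i\in[n]$; (5) $\sum_{i=1}^n e^{u_{ij}}\le 1$ for $j\in[N]$; (6) $\log\left(\eta^2 e^{\beta_{ij\ell}}+\sum_{k\ne j}e^{\zeta_{ik\ell}}\right)\le A_{ij\ell}+M\bar z_{ij}$, for all $\rho_{ij}\in[\underline\rho_{ij},\overline\rho_{ij}]$ and for all $\rho_{ik}\in[\underline\rho_{ik},\overline\rho_{ik}]$, $\ell\in[m]$, $i\in[n]$, $j\in[N]$, with $$\beta_{ij\ell}=-c(\tilde\mu_{ij}+\underline\rho_{ij}\tilde\sigma_{ij})-q_j-\frac{u_{ij}}{b_\ell},$$ $$\zeta_{ik\ell}=c\left(\tilde\mu_{ik}+\overline\rho_{ik}\tilde\sigma_{ik}-\tilde\mu_{ij}-\underline\rho_{ij}\tilde\sigma_{ij}\right)+q_k-q_j-\frac{u_{ij}}{b_\ell}.$$ Then the optimal solution $u_{ij}^\star,\bar z_{ij}^\star,q_j^\star$ of Robust-MIGP is always feasible for the chance-constrained problem (CC-MIGP, also called Stochastic MIGP) $$\min_{\bar z_{ij},u_{ij},q_j}\ \sum_{j=1}^N e^{q_j}$$ subject to constraints (1)–(5) and $$\mathbb{P}_i\left(\hat f_\ell(q_j,u_{ij})\le A_{ij\ell}+M\bar z_{ij}\right)\ge 1-\alpha_i,\qquad \ell\in[m],\ i\in[n],\ j\in[N],$$ where $$\hat f_\ell(q_j,u_{ij})=\log\left(\frac{\eta^2}{g_{ij}}e^{-q_j-\frac{u_{ij}}{b_\ell}}+\sum_{k\ne j}\frac{g_{ik}}{g_{ij}}e^{q_k-q_j-\frac{u_{ij}}{b_\ell}}\right);$$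 that is, with $x_{ij}^\star=e^{u_{ij}^\star}$ and $P_j^\star=e^{q_j^\star}$, $$\text{Robust MIGP}(u_{ij}^\star,x_{ij}^\star,P_j^\star)\implies\text{Stochastic MIGP}.$$
   Context: Notation: $[n]=\{1,\dots,n\}$; $\log$ is the natural logarithm; $\operatorname{erf}$ is the Gauss error function; sums over $k\ne j$ range over $k\in[N]\setminus\{j\}$. The quantity $\zeta_{ik\ell}$ in constraint (6) also depends on the index $j$ of the constraint in which it occurs. $\mathbb{P}_i$ denotes the probability with which the (random) throughput constraint of user $i$ is satisfied; the randomness is that of the channel gains. Interpretation: the setting is an OFDMA heterogeneous network with $n$ users and $N$ base stations. $P_j=e^{q_j}$ is the transmission power of one resource block of base station $j$, and $\hat P_j$ is its maximum physical limit. $x_{ij}=e^{u_{ij}}$ is the fraction of the bandwidth $B_j$ of base station $j$ assigned to user $i$. $\bar z_{ij}=1-z_{ij}$, where $z_{ij}=1$ if user $i$ is connected to base station $j$ and $z_{ij}=0$ otherwise. $r_i$ is the throughput requirement (bits/s) of user $i$, $\eta^2$ is the noise power, and $M$ is a sufficiently large constant (Big-M method). The constants $a_\ell,b_\ell$ ($\ell\in[m]$) are a priori calculated parameters of the $m$ power functions $a_\ell(1+S)^{b_\ell}$ used to approximate $\log_2(1+S)$, with $S$ the signal-to-interference-plus-noise ratio. The channel gain $g_{ij}$ between user $i$ and base station $j$ is log-normal: $10\log_{10}g_{ij}$ is Gaussian with mean $\tilde\mu_{ij}$ and standard deviation $\tilde\sigma_{ij}$, and $\rho_{ij}=(10\log_{10}g_{ij}-\tilde\mu_{ij})/\tilde\sigma_{ij}$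 is the normalized gain. $1-\alpha_i$ is the probability level required for the throughput constraint of user $i$.
   Formalization: For each user i the normalized gains ρ_ij, j∈[N], are additionally assumed independent; without this the claim fails, since the product of the φ_j need not be the probability of the box. *)

theory Defs
  imports "HOL-Probability.Probability"
begin

text \<open>The Gauss error function. The integral is the signed one, so \<open>erf\<close> is odd.\<close>

definition erf :: "real \<Rightarrow> real" where
  "erf x = 2 / sqrt pi * (LBINT t=0..ereal x. exp (- (t\<^sup>2)))"

text \<open>
  Users, base stations and power functions are numbered from 1; values outside these index
  ranges are irrelevant. \<open>pow_coeff\<close> and \<open>pow_expo\<close> are the constants
  \<open>a\<^sub>l\<close> and \<open>b\<^sub>l\<close> of the power functions \<open>a\<^sub>l (1 + S)\<close> to the \<open>b\<^sub>l\<close>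
  that approximate \<open>log\<^sub>2 (1 + S)\<close>; \<open>gain_mean\<close> and \<open>gain_sd\<close> are the mean and the
  standard deviation of the gain in decibel. The noise power is the square of \<open>noise\<close>.
\<close>

record network =
  num_users :: nat
  num_stations :: nat
  num_powers :: nat
  noise :: real
  big_M :: real
  max_power :: "nat \<Rightarrow> real"
  bandwidth :: "nat \<Rightarrow> real"
  throughput :: "nat \<Rightarrow> real"
  pow_coeff :: "nat \<Rightarrow> real"
  pow_expo :: "nat \<Rightarrow> real"
  gain_mean :: "nat \<Rightarrow> nat \<Rightarrow> real"
  gain_sd :: "nat \<Rightarrow> nat \<Rightarrow> real"
  risk :: "nat \<Rightarrow> real"

abbreviation users :: "network \<Rightarrow> nat set" where
  "users D \<equiv> {1..num_users D}"

abbreviation stations :: "network \<Rightarrow> nat set" where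
  "stations D \<equiv> {1..num_stations D}"

abbreviation powers :: "network \<Rightarrow> nat set" where
  "powers D \<equiv> {1..num_powers D}"

text \<open>
  Besides the conditions on the power functions, this records the positivity of the noise
  power, bandwidths, throughput requirements and standard deviations, which makes the arguments
  of the logarithms positive and the normalized gains well defined.
\<close>

definition valid_network :: "network \<Rightarrow> bool" where
  "valid_network D \<longleftrightarrow>
     0 < (noise D)\<^sup>2 \<and>
     (\<forall>j\<in>stations D. 0 < bandwidth D j) \<and>
     (\<forall>i\<in>users D. 0 < throughput D i) \<and>
     (\<forall>l\<in>powers D. 0 < pow_coeff D l \<and> 0 < pow_expo D l \<and> pow_expo D l < 1) \<and>
     (\<forall>i\<in>users D. \<forall>j\<in>stations D. 0 < gain_sd D i j)"

definition db_const :: real where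
  "db_const = ln 10 / 10"

definition A_const :: "network \<Rightarrow> nat \<Rightarrow> nat \<Rightarrow> nat \<Rightarrow> real" where
  "A_const D i j l = 1 / pow_expo D l * ln (bandwidth D j * pow_coeff D l / throughput D i)"

text \<open>The channel gain as a function of the value \<open>r\<close> of the normalized gain.\<close>

definition gain :: "network \<Rightarrow> nat \<Rightarrow> nat \<Rightarrow> real \<Rightarrow> real" where
  "gain D i j r = exp (db_const * (gain_mean D i j + r * gain_sd D i j))"

text \<open>
  The level \<open>\<phi> j\<close> is chosen separately for each user: a single \<open>\<phi>\<close> shared by all
  users would force all risks to be equal.
\<close>

definition uncertainty_box ::
  "network \<Rightarrow> 'w measure \<Rightarrow> (nat \<Rightarrow> nat \<Rightarrow> 'w \<Rightarrow> real) \<Rightarrow>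
   (nat \<Rightarrow> nat \<Rightarrow> real) \<Rightarrow> (nat \<Rightarrow> nat \<Rightarrow> real) \<Rightarrow> bool" where
  "uncertainty_box D \<Omega> \<rho> lo hi \<longleftrightarrow>
     (\<forall>i\<in>users D. \<exists>\<phi> :: nat \<Rightarrow> real.
        (\<forall>j\<in>stations D.
           measure \<Omega> {\<omega> \<in> space \<Omega>. lo i j \<le> \<rho> i j \<omega> \<and> \<rho> i j \<omega> \<le> hi i j}
             = (erf (hi i j / sqrt 2) - erf (lo i j / sqrt 2)) / 2 \<and>
           (erf (hi i j / sqrt 2) - erf (lo i j / sqrt 2)) / 2 = \<phi> j) \<and>
        (\<Prod>j\<in>stations D. \<phi> j) = 1 - risk D i)"

text \<open>The decision variables: the triple of (complemented) assignments \<open>zb\<close>, logarithmic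
  bandwidth fractions \<open>u\<close> and logarithmic powers \<open>q\<close>.\<close>

type_synonym decision = "(nat \<Rightarrow> nat \<Rightarrow> real) \<times> (nat \<Rightarrow> nat \<Rightarrow> real) \<times> (nat \<Rightarrow> real)"

definition total_power :: "network \<Rightarrow> decision \<Rightarrow> real" where
  "total_power D = (\<lambda>(zb, u, q). \<Sum>j\<in>stations D. exp (q j))"

definition basic_constraints :: "network \<Rightarrow> decision \<Rightarrow> bool" where
  "basic_constraints D = (\<lambda>(zb, u, q).
     (\<forall>i\<in>users D. \<forall>j\<in>stations D. exp (u i j) \<le> 1) \<and>
     (\<forall>i\<in>users D. \<forall>j\<in>stations D. zb i j \<in> {0, 1}) \<and>
     (\<forall>j\<in>stations D. exp (q j) \<le> max_power D j) \<and>
     (\<forall>i\<in>users D. (\<Sum>j\<in>stations D. zb i j) = real (num_stations D) - 1) \<and>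
     (\<forall>j\<in>stations D. (\<Sum>i\<in>users D. exp (u i j)) \<le> 1))"

definition beta ::
  "network \<Rightarrow> (nat \<Rightarrow> nat \<Rightarrow> real) \<Rightarrow> (nat \<Rightarrow> nat \<Rightarrow> real) \<Rightarrow> (nat \<Rightarrow> real) \<Rightarrow>
   nat \<Rightarrow> nat \<Rightarrow> nat \<Rightarrow> real" where
  "beta D lo u q i j l =
     - db_const * (gain_mean D i j + lo i j * gain_sd D i j) - q j - u i j / pow_expo D l"

definition zeta ::
  "network \<Rightarrow> (nat \<Rightarrow> nat \<Rightarrow> real) \<Rightarrow> (nat \<Rightarrow> nat \<Rightarrow> real) \<Rightarrow>
   (nat \<Rightarrow> nat \<Rightarrow> real) \<Rightarrow> (nat \<Rightarrow> real) \<Rightarrow> nat \<Rightarrow> nat \<Rightarrow> nat \<Rightarrow> nat \<Rightarrow> real" where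
  "zeta D lo hi u q i j k l =
     db_const * (gain_mean D i k + hi i k * gain_sd D i k
                 - gain_mean D i j - lo i j * gain_sd D i j)
     + q k - q j - u i j / pow_expo D l"

text \<open>
  The exponents \<open>beta\<close> and \<open>zeta\<close> already contain the worst case over the box, so the
  inequality below does not depend on the realization \<open>r\<close>; the quantifier over the box is
  that of the robust program.
\<close>

definition robust_feasible ::
  "network \<Rightarrow> (nat \<Rightarrow> nat \<Rightarrow> real) \<Rightarrow> (nat \<Rightarrow> nat \<Rightarrow> real) \<Rightarrow> decision \<Rightarrow> bool" where
  "robust_feasible D lo hi = (\<lambda>(zb, u, q).
     basic_constraints D (zb, u, q) \<and>
     (\<forall>l\<in>powers D. \<forall>i\<in>users D. \<forall>j\<in>stations D.
        \<forall>r :: nat \<Rightarrow> real. (\<forall>k\<in>stations D. r k \<in> {lo i k..hi i k}) \<longrightarrow>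
          ln ((noise D)\<^sup>2 * exp (beta D lo u q i j l)
              + (\<Sum>k\<in>stations D - {j}. exp (zeta D lo hi u q i j k l)))
          \<le> A_const D i j l + big_M D * zb i j))"

text \<open>Here \<open>g k\<close> is the realized gain between user \<open>i\<close> and base station \<open>k\<close>.\<close>

definition f_hat ::
  "network \<Rightarrow> (nat \<Rightarrow> nat \<Rightarrow> real) \<Rightarrow> (nat \<Rightarrow> real) \<Rightarrow> (nat \<Rightarrow> real) \<Rightarrow>
   nat \<Rightarrow> nat \<Rightarrow> nat \<Rightarrow> real" where
  "f_hat D u q g i j l =
     ln ((noise D)\<^sup>2 / g j * exp (- q j - u i j / pow_expo D l)
         + (\<Sum>k\<in>stations D - {j}. g k / g j * exp (q k - q j - u i j / pow_expo D l)))"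

definition chance_feasible ::
  "network \<Rightarrow> 'w measure \<Rightarrow> (nat \<Rightarrow> nat \<Rightarrow> 'w \<Rightarrow> real) \<Rightarrow> decision \<Rightarrow> bool" where
  "chance_feasible D \<Omega> \<rho> = (\<lambda>(zb, u, q).
     basic_constraints D (zb, u, q) \<and>
     (\<forall>l\<in>powers D. \<forall>i\<in>users D. \<forall>j\<in>stations D.
        measure \<Omega> {\<omega> \<in> space \<Omega>.
            f_hat D u q (\<lambda>k. gain D i k (\<rho> i k \<omega>)) i j l \<le> A_const D i j l + big_M D * zb i j}
          \<ge> 1 - risk D i))"

end

theory Submission
  imports Defs
begin

text \<open>
  The robust constraint is the throughput constraint with every gain at its worst value in the
  box: the gain of the serving station \<open>j\<close> occurs only in denominators, so it is least
  favourable at \<open>lo i j\<close>, while the gain of an interfering station occurs only in a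
  numerator, so it is least favourable at its upper end (\<open>f_hat_le_worst_case\<close>). Hence a
  robustly feasible decision, in particular an optimal one, satisfies the throughput constraint at every outcome whose
  normalized gains lie in the box, and the probability of the constraint is at least that of
  the box. By independence the latter is the product of the interval probabilities
  (\<open>prob_box\<close>), and the box is calibrated so that this product is \<open>1 - risk D i\<close>.
\<close>

text \<open>
  The argument of the logarithm is dominated term by term: the exponent of each term, with the
  gains absorbed into it, is monotone in the normalized gains because the standard deviations
  are nonnegative. Positive noise keeps the smaller argument positive even without interferers,
  as monotonicity of \<open>ln\<close> requires.
\<close>

lemma f_hat_le_worst_case:
  assumes noise: "0 < (noise D)\<^sup>2"
    and sd: "\<And>k. k \<in> stations D \<Longrightarrow> 0 \<le> gain_sd D i k"
    and j: "j \<in> stations D"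
    and box: "\<And>k. k \<in> stations D \<Longrightarrow> r k \<in> {lo i k..hi i k}"
  shows "f_hat D u q (\<lambda>k. gain D i k (r k)) i j l
           \<le> ln ((noise D)\<^sup>2 * exp (beta D lo u q i j l)
                 + (\<Sum>k\<in>stations D - {j}. exp (zeta D lo hi u q i j k l)))"
proof -
  have c: "0 \<le> db_const"
    by (simp add: db_const_def)
  have lower: "lo i j * gain_sd D i j \<le> r j * gain_sd D i j"
    using box[OF j] sd[OF j] by (auto intro: mult_right_mono)
  have noise_term: "(noise D)\<^sup>2 / gain D i j (r j) * exp (- q j - u i j / pow_expo D l)
      \<le> (noise D)\<^sup>2 * exp (beta D lo u q i j l)"
  proof -
    have "db_const * (gain_mean D i j + lo i j * gain_sd D i j)
        \<le> db_const * (gain_mean D i j + r j * gain_sd D i j)"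
      using lower c by (intro mult_left_mono) auto
    then have "exp (- q j - u i j / pow_expo D l - db_const * (gain_mean D i j + r j * gain_sd D i j))
        \<le> exp (beta D lo u q i j l)"
      by (simp add: beta_def)
    then have "exp (- q j - u i j / pow_expo D l) / gain D i j (r j) \<le> exp (beta D lo u q i j l)"
      by (simp add: gain_def exp_diff)
    from mult_left_mono[OF this, of "(noise D)\<^sup>2"] show ?thesis
      by simp
  qed
  have interference_term:
    "gain D i k (r k) / gain D i j (r j) * exp (q k - q j - u i j / pow_expo D l)
      \<le> exp (zeta D lo hi u q i j k l)" if k: "k \<in> stations D - {j}" for k
  proof -
    have "r k * gain_sd D i k \<le> hi i k * gain_sd D i k"
      using box[of k] sd[of k] k by (auto intro: mult_right_mono)
    then have "db_const * (gain_mean D i k + r k * gain_sd D i k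
                 - gain_mean D i j - r j * gain_sd D i j)
        \<le> db_const * (gain_mean D i k + hi i k * gain_sd D i k
                 - gain_mean D i j - lo i j * gain_sd D i j)"
      using lower c by (intro mult_left_mono) auto
    moreover have "gain D i k (r k) / gain D i j (r j) * exp (q k - q j - u i j / pow_expo D l)
        = exp (db_const * (gain_mean D i k + r k * gain_sd D i k
                 - gain_mean D i j - r j * gain_sd D i j) + (q k - q j - u i j / pow_expo D l))"
      by (simp add: gain_def exp_diff[symmetric] exp_add[symmetric] algebra_simps)
    ultimately show ?thesis
      by (simp add: zeta_def)
  qed
  show ?thesis
    unfolding f_hat_def
  proof (rule ln_mono)
    show "0 < (noise D)\<^sup>2 / gain D i j (r j) * exp (- q j - u i j / pow_expo D l)
        + (\<Sum>k\<in>stations D - {j}. gain D i k (r k) / gain D i j (r j)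
             * exp (q k - q j - u i j / pow_expo D l))"
      using noise by (intro add_pos_nonneg sum_nonneg) (auto simp: gain_def)
  qed (intro add_mono sum_mono noise_term interference_term)
qed

lemma (in prob_space) prob_box:
  fixes X :: "'i \<Rightarrow> 'a \<Rightarrow> real"
  assumes "indep_vars (\<lambda>_. borel) X I" "finite I" "I \<noteq> {}"
  shows "prob {\<omega> \<in> space M. \<forall>k\<in>I. a k \<le> X k \<omega> \<and> X k \<omega> \<le> b k}
           = (\<Prod>k\<in>I. prob {\<omega> \<in> space M. a k \<le> X k \<omega> \<and> X k \<omega> \<le> b k})"
proof -
  have "prob (\<Inter>k\<in>I. X k -` {a k..b k} \<inter> space M) = (\<Prod>k\<in>I. prob (X k -` {a k..b k} \<inter> space M))"
    using assms by (intro indep_varsD) auto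
  moreover have "(\<Inter>k\<in>I. X k -` {a k..b k} \<inter> space M)
      = {\<omega> \<in> space M. \<forall>k\<in>I. a k \<le> X k \<omega> \<and> X k \<omega> \<le> b k}"
    using assms(3) by auto
  moreover have "X k -` {a k..b k} \<inter> space M = {\<omega> \<in> space M. a k \<le> X k \<omega> \<and> X k \<omega> \<le> b k}" for k
    by auto
  ultimately show ?thesis
    by simp
qed

lemma measurable_f_hat:
  assumes "\<And>k. k \<in> stations D \<Longrightarrow> X k \<in> borel_measurable \<Omega>" "j \<in> stations D"
  shows "(\<lambda>\<omega>. f_hat D u q (\<lambda>k. gain D i k (X k \<omega>)) i j l) \<in> borel_measurable \<Omega>"
proof -
  have [measurable]: "(\<lambda>\<omega>. gain D i k (X k \<omega>)) \<in> borel_measurable \<Omega>" if "k \<in> stations D" for k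
    using assms(1)[OF that] unfolding gain_def by measurable
  show ?thesis
    using assms(2) unfolding f_hat_def by measurable
qed

theorem theorem1:
  fixes D :: network
    and \<Omega> :: "'w measure"
    and \<rho> :: "nat \<Rightarrow> nat \<Rightarrow> 'w \<Rightarrow> real"
    and lo hi :: "nat \<Rightarrow> nat \<Rightarrow> real"
    and zb u :: "nat \<Rightarrow> nat \<Rightarrow> real" and q :: "nat \<Rightarrow> real"
  assumes "valid_network D"
    and "prob_space \<Omega>"
    and "\<And>i j. i \<in> users D \<Longrightarrow> j \<in> stations D \<Longrightarrow> distributed \<Omega> lborel (\<rho> i j) std_normal_density"
    and "\<And>i. i \<in> users D \<Longrightarrow> prob_space.indep_vars \<Omega> (\<lambda>_. borel) (\<rho> i) (stations D)"
    and "uncertainty_box D \<Omega> \<rho> lo hi"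
    and "is_arg_min (total_power D) (robust_feasible D lo hi) (zb, u, q)"
  shows "chance_feasible D \<Omega> \<rho> (zb, u, q)"
proof -
  interpret prob_space \<Omega> by fact
  have feasible: "robust_feasible D lo hi (zb, u, q)"
    using assms(6) by (simp add: is_arg_min_def)
  have "1 - risk D i \<le> prob {\<omega> \<in> space \<Omega>.
          f_hat D u q (\<lambda>k. gain D i k (\<rho> i k \<omega>)) i j l \<le> A_const D i j l + big_M D * zb i j}"
    (is "_ \<le> prob ?ok")
    if l: "l \<in> powers D" and i: "i \<in> users D" and j: "j \<in> stations D" for i j l
  proof -
    let ?box = "{\<omega> \<in> space \<Omega>. \<forall>k\<in>stations D. lo i k \<le> \<rho> i k \<omega> \<and> \<rho> i k \<omega> \<le> hi i k}"
    have "1 - risk D i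
        = (\<Prod>k\<in>stations D. prob {\<omega> \<in> space \<Omega>. lo i k \<le> \<rho> i k \<omega> \<and> \<rho> i k \<omega> \<le> hi i k})"
    proof -
      from bspec[OF assms(5)[unfolded uncertainty_box_def] i] obtain \<phi> :: "nat \<Rightarrow> real"
        where level: "\<forall>k\<in>stations D.
            prob {\<omega> \<in> space \<Omega>. lo i k \<le> \<rho> i k \<omega> \<and> \<rho> i k \<omega> \<le> hi i k}
              = (erf (hi i k / sqrt 2) - erf (lo i k / sqrt 2)) / 2 \<and>
            (erf (hi i k / sqrt 2) - erf (lo i k / sqrt 2)) / 2 = \<phi> k"
          and total: "(\<Prod>k\<in>stations D. \<phi> k) = 1 - risk D i"
        by (elim exE conjE) (rule that)
      have "prob {\<omega> \<in> space \<Omega>. lo i k \<le> \<rho> i k \<omega> \<and> \<rho> i k \<omega> \<le> hi i k} = \<phi> k"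
        if "k \<in> stations D" for k
        using bspec[OF level that] by (elim conjE) (rule trans)
      then show ?thesis
        unfolding total[symmetric] by (intro prod.cong) simp_all
    qed
    also have "\<dots> = prob ?box"
      using j by (intro prob_box[OF assms(4)[OF i], symmetric]) auto
    also have "\<dots> \<le> prob ?ok"
    proof (rule finite_measure_mono)
      show "?box \<subseteq> ?ok"
      proof safe
        fix \<omega> assume "\<forall>k\<in>stations D. lo i k \<le> \<rho> i k \<omega> \<and> \<rho> i k \<omega> \<le> hi i k"
        then have box: "\<forall>k\<in>stations D. \<rho> i k \<omega> \<in> {lo i k..hi i k}"
          by simp
        have "f_hat D u q (\<lambda>k. gain D i k (\<rho> i k \<omega>)) i j l
            \<le> ln ((noise D)\<^sup>2 * exp (beta D lo u q i j l)
                 + (\<Sum>k\<in>stations D - {j}. exp (zeta D lo hi u q i j k l)))"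
          using assms(1) i j box
          by (intro f_hat_le_worst_case) (auto simp: valid_network_def intro: less_imp_le)
        \<comment> \<open>The robust constraint is quantified over the points of the box, so it is vacuous
          for an empty box; here the realized gains themselves provide a point.\<close>
        also have "\<dots> \<le> A_const D i j l + big_M D * zb i j"
          using feasible l i j box unfolding robust_feasible_def prod.case
          by (elim conjE) (drule bspec[OF _ l], drule bspec[OF _ i], drule bspec[OF _ j], erule allE, erule mp)
        finally show "f_hat D u q (\<lambda>k. gain D i k (\<rho> i k \<omega>)) i j l
            \<le> A_const D i j l + big_M D * zb i j" .
      qed
      have "\<rho> i k \<in> borel_measurable \<Omega>" if "k \<in> stations D" for k
        using assms(4)[OF i] that by (auto simp: indep_vars_def)
      then have [measurable]:
        "(\<lambda>\<omega>. f_hat D u q (\<lambda>k. gain D i k (\<rho> i k \<omega>)) i j l) \<in> borel_measurable \<Omega>"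
        using j by (rule measurable_f_hat)
      show "?ok \<in> events"
        by measurable
    qed
    finally show ?thesis .
  qed
  then show ?thesis
    using feasible by (simp add: chance_feasible_def robust_feasible_def)
qed

end
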